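(* Let $H_3=\mathbb{R}^3$ with coordinates $(x,y,z)$ be the Heisenberg group with the left-invariant Lorentzian metric $$g_1=-dx^2+dy^2+(x\,dy+dz)^2 .$$ A smooth vector field $X$ on $H_3$ and a constant $\lambda\in\mathbb{R}$ satisfy $\mathcal{L}_Xg_1+C=\lambda g_1$ if and only if $\lambda=2$ and $$X=\left(\kappa_1y+\tfrac34x+\kappa_2\right)\partial_x+\left(\kappa_1x+\tfrac34y+\kappa_3\right)\partial_y-\left(\tfrac{\kappa_1}{2}(x^2+y^2)+\kappa_2y-\tfrac32z-\kappa_4\right)\partial_z$$ for some $\kappa_1,\kappa_2,\kappa_3,\kappa_4\in\mathbb{R}$. Moreover $C\neq0$, and none of these Cotton solitons is left-invariant or gradient.
   Context: Let $\nabla$ be the Levi-Civita connection of a three-dimensional pseudo-Riemannian manifold, $R(X,Y)=\nabla_{[X,Y]}-[\nabla_X,\nabla_Y]$, Ricci tensor $\rho(X,Y)=\operatorname{trace}\{Z\mapsto R(X,Z)Y\}$, scalar curvature $\tau$, Schouten tensor $S=\rho-\frac{\tau}{4}g$. The $(0,3)$-Cotton tensor is $C_{ijk}=(\nabla_iS)_{jk}-(\nabla_jS)_{ik}$, and the $(0,2)$-Cotton tensor is $C_{ij}=\frac{1}{2\sqrt{|\det g|}}C_{nmi}\,\epsilon^{nm\ell}g_{\ell j}$, where $\epsilon^{ijk}$ is the Levi-Civita symbol with $\epsilon^{123}=1$; here the orientation is the one for which $(\partial_x,\partial_y,\partial_z)$ is positively oriented. A Cotton soliton is a vector field $X$ with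 $\mathcal{L}_Xg+C=\lambda g$ for some $\lambda\in\mathbb{R}$; it is gradient if $X=\nabla f$ for some smooth function $f$. The left-invariant vector fields on $H_3$ are the constant-coefficient linear combinations of $\partial_x$, $\partial_y-x\partial_z$, $\partial_z$. *)

theory Defs
  imports "HOL-Analysis.Analysis"
begin

text \<open>
  Tensor calculus on R^3 in the global coordinates (x, y, z) = (p$1, p$2, p$3).  A vector field is
  given by its components with respect to the coordinate fields; a field of type
  \<open>tensor2\<close> holds the components T_ij (first index = row) of a (0,2)-tensor field.
\<close>

type_synonym scalar_field = "real^3 \<Rightarrow> real"
type_synonym vector_field = "real^3 \<Rightarrow> real^3"
type_synonym tensor2 = "real^3 \<Rightarrow> real^3^3"

definition pd :: "3 \<Rightarrow> scalar_field \<Rightarrow> scalar_field" where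
  "pd i f p = frechet_derivative f (at p) (axis i 1)"

text \<open>
  Class C^k on all of R^3: continuous for k = 0; for k + 1, differentiable with all
  first partial derivatives of class C^k.
\<close>

primrec Ck :: "nat \<Rightarrow> scalar_field \<Rightarrow> bool" where
  "Ck 0 f \<longleftrightarrow> continuous_on UNIV f"
| "Ck (Suc k) f \<longleftrightarrow> f differentiable_on UNIV \<and> (\<forall>i. Ck k (pd i f))"

definition smooth_fun :: "scalar_field \<Rightarrow> bool" where
  "smooth_fun f \<longleftrightarrow> (\<forall>k. Ck k f)"

definition smooth_field :: "vector_field \<Rightarrow> bool" where
  "smooth_field X \<longleftrightarrow> (\<forall>i. smooth_fun (\<lambda>p. X p $ i))"

definition coord_field :: "3 \<Rightarrow> vector_field" where
  "coord_field i p = axis i 1"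

definition lie_bracket :: "vector_field \<Rightarrow> vector_field \<Rightarrow> vector_field" where
  "lie_bracket X Y p =
     (\<chi> k. \<Sum>i\<in>UNIV. X p $ i * pd i (\<lambda>q. Y q $ k) p - Y p $ i * pd i (\<lambda>q. X q $ k) p)"

text \<open>\<open>christoffel g k i j\<close> has the upper index first; it is the Levi-Civita connection of \<open>g\<close>.\<close>

definition christoffel :: "tensor2 \<Rightarrow> 3 \<Rightarrow> 3 \<Rightarrow> 3 \<Rightarrow> scalar_field" where
  "christoffel g k i j p = (1/2) * (\<Sum>l\<in>UNIV. matrix_inv (g p) $ k $ l *
     (pd i (\<lambda>q. g q $ j $ l) p + pd j (\<lambda>q. g q $ i $ l) p - pd l (\<lambda>q. g q $ i $ j) p))"

definition nabla :: "tensor2 \<Rightarrow> vector_field \<Rightarrow> vector_field \<Rightarrow> vector_field" where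
  "nabla g X Y p = (\<chi> k. (\<Sum>i\<in>UNIV. X p $ i * pd i (\<lambda>q. Y q $ k) p)
     + (\<Sum>i\<in>UNIV. \<Sum>j\<in>UNIV. christoffel g k i j p * X p $ i * Y p $ j))"

text \<open>Sign convention: R(X,Y) = nabla_[X,Y] - [nabla_X, nabla_Y], the negative of the more common one.\<close>

definition curvature ::
    "tensor2 \<Rightarrow> vector_field \<Rightarrow> vector_field \<Rightarrow> vector_field \<Rightarrow> vector_field" where
  "curvature g X Y Z p =
     nabla g (lie_bracket X Y) Z p - (nabla g X (nabla g Y Z) p - nabla g Y (nabla g X Z) p)"

text \<open>The Ricci tensor at (X,Y) is the trace of Z |-> R(X,Z)Y.\<close>

definition ricci :: "tensor2 \<Rightarrow> tensor2" where
  "ricci g p = (\<chi> i j. \<Sum>k\<in>UNIV.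
     curvature g (coord_field i) (coord_field k) (coord_field j) p $ k)"

definition scalar_curvature :: "tensor2 \<Rightarrow> scalar_field" where
  "scalar_curvature g p = (\<Sum>i\<in>UNIV. \<Sum>j\<in>UNIV. matrix_inv (g p) $ i $ j * ricci g p $ i $ j)"

definition schouten :: "tensor2 \<Rightarrow> tensor2" where
  "schouten g p = ricci g p - (scalar_curvature g p / 4) *\<^sub>R g p"

text \<open>\<open>cov_deriv g T i j k\<close> is (nabla_i T)_jk.\<close>

definition cov_deriv :: "tensor2 \<Rightarrow> tensor2 \<Rightarrow> 3 \<Rightarrow> 3 \<Rightarrow> 3 \<Rightarrow> scalar_field" where
  "cov_deriv g T i j k p = pd i (\<lambda>q. T q $ j $ k) p
     - (\<Sum>l\<in>UNIV. christoffel g l i j p * T p $ l $ k)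
     - (\<Sum>l\<in>UNIV. christoffel g l i k p * T p $ j $ l)"

definition cotton3 :: "tensor2 \<Rightarrow> 3 \<Rightarrow> 3 \<Rightarrow> 3 \<Rightarrow> scalar_field" where
  "cotton3 g i j k p = cov_deriv g (schouten g) i j k p - cov_deriv g (schouten g) j i k p"

definition levi_civita_symbol :: "3 \<Rightarrow> 3 \<Rightarrow> 3 \<Rightarrow> real" where
  "levi_civita_symbol i j k =
     (if (i, j, k) \<in> {(1, 2, 3), (2, 3, 1), (3, 1, 2)} then 1
      else if (i, j, k) \<in> {(2, 1, 3), (1, 3, 2), (3, 2, 1)} then -1
      else 0)"

text \<open>The orientation is the one for which the coordinate frame is positively oriented.\<close>

definition cotton :: "tensor2 \<Rightarrow> tensor2" where
  "cotton g p = (\<chi> i j. 1 / (2 * sqrt \<bar>det (g p)\<bar>) *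
     (\<Sum>n\<in>UNIV. \<Sum>m\<in>UNIV. \<Sum>l\<in>UNIV.
        cotton3 g n m i p * levi_civita_symbol n m l * g p $ l $ j))"

definition lie_derivative :: "vector_field \<Rightarrow> tensor2 \<Rightarrow> tensor2" where
  "lie_derivative X T p = (\<chi> i j. \<Sum>k\<in>UNIV.
     X p $ k * pd k (\<lambda>q. T q $ i $ j) p
     + T p $ k $ j * pd i (\<lambda>q. X q $ k) p
     + T p $ i $ k * pd j (\<lambda>q. X q $ k) p)"

definition cotton_soliton :: "tensor2 \<Rightarrow> vector_field \<Rightarrow> real \<Rightarrow> bool" where
  "cotton_soliton g X c \<longleftrightarrow>
     smooth_field X \<and> (\<forall>p. lie_derivative X g p + cotton g p = c *\<^sub>R g p)"

definition gradient :: "tensor2 \<Rightarrow> scalar_field \<Rightarrow> vector_field" where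
  "gradient g f p = matrix_inv (g p) *v (\<chi> j. pd j f p)"

definition is_gradient_field :: "tensor2 \<Rightarrow> vector_field \<Rightarrow> bool" where
  "is_gradient_field g X \<longleftrightarrow> (\<exists>f. smooth_fun f \<and> X = gradient g f)"

definition left_invariant :: "vector_field \<Rightarrow> bool" where
  "left_invariant X \<longleftrightarrow> (\<exists>a b c :: real. \<forall>p.
     X p = a *\<^sub>R vector [1, 0, 0] + b *\<^sub>R vector [0, 1, - (p $ 1)] + c *\<^sub>R vector [0, 0, 1])"

definition form_square :: "real^3 \<Rightarrow> real^3^3" where
  "form_square \<alpha> = (\<chi> i j. \<alpha> $ i * \<alpha> $ j)"

text \<open>g_1 = - dx^2 + dy^2 + (x dy + dz)^2; \<open>axis i 1\<close> here holds the components of the i-th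
  coordinate 1-form.\<close>

definition g1 :: tensor2 where
  "g1 p = - form_square (axis 1 1) + form_square (axis 2 1)
     + form_square ((p $ 1) *\<^sub>R axis 2 1 + axis 3 1)"

end

theory Submission
  imports Defs
begin

text \<open>
  The idea is to write the soliton equation in the left-invariant frame \<open>\<partial>_x\<close>,
  \<open>\<partial>_y - x \<partial>_z\<close>, \<open>\<partial>_z\<close>, in which the metric is diagonal with entries -1, 1, 1.  A direct
  computation of the curvature shows that the Cotton tensor is also diagonal in this frame, with
  entries -1/2, 1/2, -1 (\<open>cotton_g1\<close>).  If X has frame components a, b and
  h = x X^2 + X^3 = (x dy + dz)(X), the soliton equation becomes the six linear first-order
  equations of \<open>soliton_frame_equations\<close>; they fix a_x, h_z and the remaining first derivatives of
  h and b in terms of a, b and of a_y, A = a_z, B = b_z.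

  Such an overdetermined system is solved by equating mixed second derivatives
  (\<open>frame_system_solution\<close>).  Applied to h they say that A_z = -B, B_z = -A and, together with the
  other equations, that (c + 1)/2 = c - 1/2; the last relation forces c = 2.  Applied to a and b
  they say A_x = 0, B_x = 0 and A_y = - x B.  Differentiating this in x gives B = 0, hence A = 0,
  and then all first derivatives of a and b are constant.  What is left is to integrate: the four
  constants of integration are the parameters of the family.  Conversely these polynomial fields
  satisfy the equation by substitution.

  A left-invariant field has constant \<open>\<partial>_x\<close>-component, whereas here its x-derivative is 3/4.
  If X were the gradient of f, then f_x = -a and f_z = h, so that f_zx = f_xz would read
  b = h_x = -a_z = 0, whereas the y-derivative of b is 3/4.
\<close>

section \<open>Partial derivatives and smooth functions\<close>

lemma pd_eqI: "(f has_derivative D) (at p) \<Longrightarrow> pd i f p = D (axis i 1)"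
  unfolding pd_def by (simp flip: frechet_derivative_at)

lemma pd_const [simp]: "pd i (\<lambda>q. c) = (\<lambda>p. 0)"
  by (rule ext, rule pd_eqI[THEN trans], rule has_derivative_const, simp)

lemma pd_coord [simp]: "pd i (\<lambda>q. q $ j) = (\<lambda>p. if i = j then 1 else 0)"
  by (rule ext, rule pd_eqI[THEN trans],
      rule bounded_linear_imp_has_derivative[OF bounded_linear_vec_nth], simp add: axis_def)

lemma differentiable_coord [simp]: "(\<lambda>q. q $ j) differentiable (at (p :: real^'n))"
  using bounded_linear_imp_differentiable bounded_linear_vec_nth by blast

lemma pd_add [simp]:
  "f differentiable (at p) \<Longrightarrow> g differentiable (at p) \<Longrightarrow>
    pd i (\<lambda>q. f q + g q) p = pd i f p + pd i g p"
  by (rule pd_eqI[THEN trans], rule has_derivative_add)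
     (auto simp: frechet_derivative_works pd_def)

lemma pd_minus [simp]:
  "f differentiable (at p) \<Longrightarrow> pd i (\<lambda>q. - f q) p = - pd i f p"
  by (rule pd_eqI[THEN trans], rule has_derivative_minus)
     (auto simp: frechet_derivative_works pd_def)

lemma pd_diff [simp]:
  "f differentiable (at p) \<Longrightarrow> g differentiable (at p) \<Longrightarrow>
    pd i (\<lambda>q. f q - g q) p = pd i f p - pd i g p"
  by (rule pd_eqI[THEN trans], rule has_derivative_diff)
     (auto simp: frechet_derivative_works pd_def)

lemma pd_mult [simp]:
  "f differentiable (at p) \<Longrightarrow> g differentiable (at p) \<Longrightarrow>
    pd i (\<lambda>q. f q * g q) p = f p * pd i g p + pd i f p * g p"
  by (rule pd_eqI[THEN trans], rule has_derivative_mult)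
     (auto simp: frechet_derivative_works pd_def)

lemma pd_divide_const [simp]:
  assumes "f differentiable (at p)"
  shows "pd i (\<lambda>q. f q / c) p = pd i f p / c"
  using pd_mult[OF assms differentiable_const[of "1 / c"], of i] by simp

lemma differentiable_divide_const [simp]:
  fixes f :: "real^'n \<Rightarrow> real"
  assumes "f differentiable (at p)"
  shows "(\<lambda>q. f q / c) differentiable (at p)"
  using differentiable_mult[OF assms differentiable_const[of "1 / c"]] by simp

lemma Ck_Suc_imp_Ck: "Ck (Suc k) f \<Longrightarrow> Ck k f"
  by (induction k arbitrary: f) (auto simp: differentiable_imp_continuous_on)

lemma Ck_const: "Ck k (\<lambda>q. c)"
  by (induction k arbitrary: c) (auto simp: continuous_on_const)

lemma Ck_coord: "Ck k (\<lambda>q. q $ j)"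
  by (cases k) (auto simp: Ck_const differentiable_on_def continuous_on_component differentiable_at_withinI)

lemma Ck_Suc_differentiable: "Ck (Suc k) f \<Longrightarrow> f differentiable (at p)"
  by (simp add: differentiable_on_def)

lemma Ck_add: "Ck k f \<Longrightarrow> Ck k g \<Longrightarrow> Ck k (\<lambda>q. f q + g q)"
proof (induction k arbitrary: f g)
  case 0
  then show ?case by (simp add: continuous_on_add)
next
  case (Suc k)
  have "pd i (\<lambda>q. f q + g q) = (\<lambda>q. pd i f q + pd i g q)" for i
    using Suc.prems by (simp add: fun_eq_iff Ck_Suc_differentiable del: Ck.simps)
  with Suc show ?case by simp
qed

lemma Ck_mult: "Ck k f \<Longrightarrow> Ck k g \<Longrightarrow> Ck k (\<lambda>q. f q * g q)"
proof (induction k arbitrary: f g)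
  case 0
  then show ?case by (simp add: continuous_on_mult)
next
  case (Suc k)
  have "pd i (\<lambda>q. f q * g q) = (\<lambda>q. f q * pd i g q + pd i f q * g q)" for i
    using Suc.prems by (simp add: fun_eq_iff Ck_Suc_differentiable del: Ck.simps)
  moreover have "Ck k (\<lambda>q. f q * pd i g q + pd i f q * g q)" for i
    using Suc.prems by (intro Ck_add Suc.IH) (blast intro: Ck_Suc_imp_Ck, simp, simp, blast intro: Ck_Suc_imp_Ck)
  ultimately show ?case using Suc.prems by simp
qed

lemma smooth_const: "smooth_fun (\<lambda>q. c)"
  and smooth_coord: "smooth_fun (\<lambda>q. q $ j)"
  and smooth_add: "smooth_fun f \<Longrightarrow> smooth_fun g \<Longrightarrow> smooth_fun (\<lambda>q. f q + g q)"
  and smooth_mult: "smooth_fun f \<Longrightarrow> smooth_fun g \<Longrightarrow> smooth_fun (\<lambda>q. f q * g q)"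
  by (simp_all add: smooth_fun_def Ck_const Ck_coord Ck_add Ck_mult)

lemma smooth_pd: "smooth_fun f \<Longrightarrow> smooth_fun (pd i f)"
  by (metis smooth_fun_def Ck.simps(2))

lemma smooth_imp_differentiable: "smooth_fun f \<Longrightarrow> f differentiable (at p)"
  by (metis smooth_fun_def Ck.simps(2) differentiable_on_eq_differentiable_at open_UNIV UNIV_I)

lemma frechet_derivative_eq_sum_pd:
  assumes "f differentiable (at p)"
  shows "frechet_derivative f (at p) v = (\<Sum>i\<in>UNIV. v $ i * pd i f p)"
proof -
  have lin: "linear (frechet_derivative f (at p))"
    using assms linear_frechet_derivative by blast
  have "frechet_derivative f (at p) v
      = frechet_derivative f (at p) (\<Sum>i\<in>UNIV. v $ i *\<^sub>R axis i 1)"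
    by (simp add: basis_expansion flip: scalar_mult_eq_scaleR)
  also have "\<dots> = (\<Sum>i\<in>UNIV. v $ i * pd i f p)"
    by (simp add: linear_sum[OF lin] linear_scale[OF lin] pd_def)
  finally show ?thesis .
qed

lemma pd_zero_imp_const:
  assumes "\<And>p. f differentiable (at p)"
    and "\<And>p. pd 1 f p = 0" "\<And>p. pd 2 f p = 0" "\<And>p. pd 3 f p = 0"
  shows "\<exists>c. \<forall>p. f p = c"
proof -
  have "(f has_derivative (\<lambda>v. 0)) (at p)" for p
  proof -
    have "frechet_derivative f (at p) = (\<lambda>v. 0)"
      using assms by (simp add: fun_eq_iff frechet_derivative_eq_sum_pd sum_3)
    with assms(1)[of p] show ?thesis
      by (simp add: frechet_derivative_works)
  qed
  then have "f p = f 0" for p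
    using has_derivative_zero_unique[of UNIV f p 0] by auto
  then show ?thesis by blast
qed

lemma has_real_derivative_along_axis:
  assumes "f differentiable (at (q + s *\<^sub>R axis i 1))"
  shows "((\<lambda>t. f (q + t *\<^sub>R axis i 1)) has_real_derivative pd i f (q + s *\<^sub>R axis i 1)) (at s)"
proof -
  let ?D = "frechet_derivative f (at (q + s *\<^sub>R axis i 1))"
  have "((\<lambda>t. f (q + t *\<^sub>R axis i 1)) has_derivative (\<lambda>t. ?D (t *\<^sub>R axis i 1))) (at s)"
    by (rule has_derivative_compose[of "\<lambda>t. q + t *\<^sub>R axis i 1"])
       (use assms in \<open>auto intro!: derivative_eq_intros simp: frechet_derivative_works\<close>)
  then show ?thesis
    using linear_scale[OF linear_frechet_derivative[OF assms]]
    by (simp add: has_field_derivative_def pd_def mult_commute_abs)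
qed

text \<open>
  The mean value theorem in direction i is applied to the difference of f along j, and then the mean
  value theorem in direction j to the i-th partial derivative.  The left-hand side is symmetric in i
  and j, so exchanging them gives the other mixed derivative.
\<close>

lemma second_difference_eq_mixed_pd:
  assumes f: "Ck 2 f" and t: "t > 0"
  shows "\<exists>\<xi> \<eta>. 0 < \<xi> \<and> \<xi> < t \<and> 0 < \<eta> \<and> \<eta> < t \<and>
    f (p + t *\<^sub>R axis i 1 + t *\<^sub>R axis j 1) - f (p + t *\<^sub>R axis i 1)
      - f (p + t *\<^sub>R axis j 1) + f p
    = t * t * pd j (pd i f) (p + \<xi> *\<^sub>R axis i 1 + \<eta> *\<^sub>R axis j 1)"
proof -
  have df: "f differentiable (at q)" and dpf: "pd i f differentiable (at q)" for q
    using f by (auto simp: numeral_2_eq_2 differentiable_on_def)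
  define F where "F s = f ((p + t *\<^sub>R axis j 1) + s *\<^sub>R axis i 1) - f (p + s *\<^sub>R axis i 1)" for s
  have "(F has_real_derivative
      (pd i f ((p + t *\<^sub>R axis j 1) + s *\<^sub>R axis i 1) - pd i f (p + s *\<^sub>R axis i 1))) (at s)" for s
    unfolding F_def by (intro DERIV_diff has_real_derivative_along_axis df)
  from MVT2[OF t this] obtain \<xi> where \<xi>: "0 < \<xi>" "\<xi> < t"
    "F t - F 0 = t * (pd i f ((p + t *\<^sub>R axis j 1) + \<xi> *\<^sub>R axis i 1) - pd i f (p + \<xi> *\<^sub>R axis i 1))"
    by auto
  define G where "G s = pd i f ((p + \<xi> *\<^sub>R axis i 1) + s *\<^sub>R axis j 1)" for s
  have "(G has_real_derivative pd j (pd i f) ((p + \<xi> *\<^sub>R axis i 1) + s *\<^sub>R axis j 1)) (at s)" for s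
    unfolding G_def by (intro has_real_derivative_along_axis dpf)
  from MVT2[OF t this] obtain \<eta> where \<eta>: "0 < \<eta>" "\<eta> < t"
    "G t - G 0 = t * pd j (pd i f) ((p + \<xi> *\<^sub>R axis i 1) + \<eta> *\<^sub>R axis j 1)"
    by auto
  have "F t - F 0 = t * t * pd j (pd i f) (p + \<xi> *\<^sub>R axis i 1 + \<eta> *\<^sub>R axis j 1)"
    using \<xi>(3) \<eta>(3) by (simp add: G_def algebra_simps)
  with \<xi>(1,2) \<eta>(1,2) show ?thesis
    by (intro exI[of _ \<xi>] exI[of _ \<eta>]) (simp add: F_def algebra_simps)
qed

text \<open>
  Both orders of differentiation are recovered, by the mean value theorem, from the same second
  difference over a square of side t; continuity at the corner identifies them as t tends to 0.
\<close>

lemma pd_commute: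
  assumes "Ck 2 f"
  shows "pd i (pd j f) p = pd j (pd i f) p"
proof (rule ccontr)
  assume neq: "pd i (pd j f) p \<noteq> pd j (pd i f) p"
  define e where "e = dist (pd i (pd j f) p) (pd j (pd i f) p) / 2"
  have e: "e > 0" using neq by (simp add: e_def)
  have cont: "isCont (pd k (pd l f)) p" for k l
    using assms by (auto simp: numeral_2_eq_2 continuous_on_eq_continuous_at)
  obtain d1 where d1: "d1 > 0" "\<And>q. dist q p < d1 \<Longrightarrow> dist (pd i (pd j f) q) (pd i (pd j f) p) < e"
    using cont[of i j] e unfolding continuous_at_eps_delta by blast
  obtain d2 where d2: "d2 > 0" "\<And>q. dist q p < d2 \<Longrightarrow> dist (pd j (pd i f) q) (pd j (pd i f) p) < e"
    using cont[of j i] e unfolding continuous_at_eps_delta by blast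
  define t where "t = min d1 d2 / 2"
  have t: "t > 0" using d1 d2 by (simp add: t_def)
  have near: "dist (p + \<xi> *\<^sub>R axis k 1 + \<eta> *\<^sub>R axis l 1) p < min d1 d2"
    if "0 < \<xi>" "\<xi> < t" "0 < \<eta>" "\<eta> < t" for \<xi> \<eta> and k l :: 3
    using that norm_triangle_ineq[of "\<xi> *\<^sub>R axis k 1" "\<eta> *\<^sub>R axis l (1::real)"]
    by (simp add: dist_norm add.assoc t_def)
  obtain \<xi> \<eta> where 1: "0 < \<xi>" "\<xi> < t" "0 < \<eta>" "\<eta> < t"
    "f (p + t *\<^sub>R axis i 1 + t *\<^sub>R axis j 1) - f (p + t *\<^sub>R axis i 1)
      - f (p + t *\<^sub>R axis j 1) + f p
    = t * t * pd j (pd i f) (p + \<xi> *\<^sub>R axis i 1 + \<eta> *\<^sub>R axis j 1)"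
    using second_difference_eq_mixed_pd[OF assms t] by blast
  obtain \<xi>' \<eta>' where 2: "0 < \<xi>'" "\<xi>' < t" "0 < \<eta>'" "\<eta>' < t"
    "f (p + t *\<^sub>R axis j 1 + t *\<^sub>R axis i 1) - f (p + t *\<^sub>R axis j 1)
      - f (p + t *\<^sub>R axis i 1) + f p
    = t * t * pd i (pd j f) (p + \<xi>' *\<^sub>R axis j 1 + \<eta>' *\<^sub>R axis i 1)"
    using second_difference_eq_mixed_pd[OF assms t] by blast
  define u where "u = pd j (pd i f) (p + \<xi> *\<^sub>R axis i 1 + \<eta> *\<^sub>R axis j 1)"
  define v where "v = pd i (pd j f) (p + \<xi>' *\<^sub>R axis j 1 + \<eta>' *\<^sub>R axis i 1)"
  have "t * t * u = t * t * v"
    using 1(5) 2(5) unfolding u_def v_def by (simp add: algebra_simps)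
  then have "u = v"
    using t by simp
  moreover have "dist u (pd j (pd i f) p) < e"
    unfolding u_def using near[OF 1(1-4), of i j] by (intro d2(2)) linarith
  moreover have "dist v (pd i (pd j f) p) < e"
    unfolding v_def using near[OF 2(1-4), of j i] by (intro d1(2)) linarith
  ultimately show False
    using dist_triangle3[of "pd i (pd j f) p" "pd j (pd i f) p" u] by (simp add: e_def)
qed

section \<open>Curvature and Cotton tensor of the metric\<close>

lemma g1_table:
  "\<forall>i j. g1 p $ i $ j = (vector [vector [-1, 0, 0],
                                 vector [0, 1 + p$1 * p$1, p$1],
                                 vector [0, p$1, 1]] :: real^3^3) $ i $ j"
  by (simp add: forall_3 g1_def form_square_def axis_def)

lemmas g1_nth = g1_table[unfolded forall_3 vector_3]

lemma matrix_inv_eqI: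
  fixes A B :: "real^'n^'n"
  assumes "A ** B = mat 1"
  shows "matrix_inv A = B"
proof -
  have BA: "B ** A = mat 1"
    using assms by (simp add: matrix_left_right_inverse)
  have uniq: "B' = B" if "A ** B' = mat 1" for B'
  proof -
    have "B' = (B ** A) ** B'" by (simp add: BA)
    also have "\<dots> = B ** (A ** B')" by (rule matrix_mul_assoc[symmetric])
    finally show ?thesis by (simp add: that)
  qed
  show ?thesis
    unfolding matrix_inv_def
  proof (rule some_equality)
    show "A ** B = mat 1 \<and> B ** A = mat 1" using assms BA ..
  qed (blast intro: uniq)
qed

lemma matrix_inv_g1:
  "matrix_inv (g1 p) = vector [vector [-1, 0, 0],
                               vector [0, 1, - p$1],
                               vector [0, - p$1, 1 + p$1 * p$1]]"
  by (rule matrix_inv_eqI)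
     (simp add: g1_nth vec_eq_iff forall_3 sum_3 matrix_matrix_mult_def mat_def algebra_simps)

lemma det_g1: "det (g1 p) = -1"
  by (simp add: det_3 g1_nth)

text \<open>
  Coordinates are used rather than the frame because every entry is then a polynomial in x alone.
  The table is split into single entries before it is used for rewriting, so that no lookup in it
  with symbolic indices ever arises.
\<close>

lemma christoffel_g1_table:
  "\<forall>k i j. christoffel g1 k i j = (\<lambda>p. (vector
     [vector [vector [0, 0, 0], vector [0, p$1, 1/2], vector [0, 1/2, 0]],
      vector [vector [0, p$1 / 2, 1/2], vector [p$1 / 2, 0, 0], vector [1/2, 0, 0]],
      vector [vector [0, (1 - p$1 * p$1) / 2, - p$1 / 2],
              vector [(1 - p$1 * p$1) / 2, 0, 0],
              vector [- p$1 / 2, 0, 0]]] :: real^3^3^3) $ k $ i $ j)"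
  unfolding forall_3 vector_3
  by (simp add: fun_eq_iff christoffel_def sum_3 matrix_inv_g1 g1_nth)

lemmas christoffel_g1 = christoffel_g1_table[unfolded forall_3 vector_3]

lemma nabla_coord_field:
  "nabla g (coord_field i) Y p $ k
    = pd i (\<lambda>q. Y q $ k) p + (\<Sum>j\<in>UNIV. christoffel g k i j p * Y p $ j)"
proof -
  have "(\<Sum>m\<in>UNIV. \<Sum>j\<in>UNIV. christoffel g k m j p * coord_field i p $ m * Y p $ j)
      = (\<Sum>m\<in>UNIV. if m = i then \<Sum>j\<in>UNIV. christoffel g k i j p * Y p $ j else 0)"
    by (intro sum.cong refl) (simp add: coord_field_def axis_def)
  moreover have "(\<Sum>m\<in>UNIV. coord_field i p $ m * pd m (\<lambda>q. Y q $ k) p)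
      = (\<Sum>m\<in>UNIV. if m = i then pd i (\<lambda>q. Y q $ k) p else 0)"
    by (intro sum.cong refl) (simp add: coord_field_def axis_def)
  ultimately show ?thesis
    by (simp add: nabla_def)
qed

text \<open>
  The classical coordinate formula, with the sign of the present convention; coordinate fields
  commute, so the bracket term vanishes.
\<close>

lemma curvature_coord_fields:
  "curvature g (coord_field i) (coord_field k) (coord_field j) p $ l
    = pd k (christoffel g l i j) p - pd i (christoffel g l k j) p
      + (\<Sum>m\<in>UNIV. christoffel g l k m p * christoffel g m i j p
                 - christoffel g l i m p * christoffel g m k j p)"
proof -
  have "lie_bracket (coord_field i) (coord_field k) = (\<lambda>p. 0)"
    by (simp add: fun_eq_iff vec_eq_iff lie_bracket_def coord_field_def)
  then have 1: "nabla g (lie_bracket (coord_field i) (coord_field k)) Z p $ l = 0" for Z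
    by (simp add: nabla_def)
  have 2: "nabla g (coord_field i) (coord_field j) q $ m = christoffel g m i j q" for q m i j
    unfolding nabla_coord_field
    by (simp add: coord_field_def axis_def if_distrib if_distribR sum.delta' cong: if_cong)
  show ?thesis
    by (simp add: curvature_def 1 nabla_coord_field[where Y = "nabla g _ _"] 2 sum_subtractf)
qed

lemma ricci_g1:
  "ricci g1 p = vector [vector [-1/2, 0, 0],
                        vector [0, (1 - p$1 * p$1) / 2, - p$1 / 2],
                        vector [0, - p$1 / 2, -1/2]]"
  by (simp add: vec_eq_iff forall_3 ricci_def curvature_coord_fields christoffel_g1 sum_3 field_simps)

lemma schouten_g1:
  "schouten g1 p = vector [vector [-3/8, 0, 0],
                           vector [0, (3 - 5 * p$1 * p$1) / 8, - 5 * p$1 / 8],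
                           vector [0, - 5 * p$1 / 8, -5/8]]"
proof -
  have "scalar_curvature g1 p = 1 / 2"
    by (simp add: scalar_curvature_def sum_3 ricci_g1 matrix_inv_g1 field_simps)
  then show ?thesis
    by (simp add: vec_eq_iff forall_3 schouten_def ricci_g1 g1_nth) (simp add: field_simps)
qed

text \<open>In terms of 1-forms this is \<open>1/2 (- dx^2 + dy^2) - (x dy + dz)^2\<close>.\<close>

lemma cotton_g1:
  "cotton g1 p = vector [vector [-1/2, 0, 0],
                         vector [0, 1/2 - p$1 * p$1, - p$1],
                         vector [0, - p$1, -1]]"
  by (simp add: vec_eq_iff forall_3 cotton_def det_g1 cotton3_def cov_deriv_def
      schouten_g1 christoffel_g1 g1_nth sum_3 levi_civita_symbol_def field_simps)

lemma smooth_pd_commute: "smooth_fun f \<Longrightarrow> pd i (pd j f) = pd j (pd i f)"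
  using pd_commute by (auto simp: smooth_fun_def fun_eq_iff)

section \<open>The soliton equation\<close>

text \<open>
  The equations state, in frame components, that the Lie derivative of the metric along
  \<open>a \<partial>_x + b (\<partial>_y - x \<partial>_z) + h \<partial>_z\<close> is \<open>2 m (- dx^2 + dy^2) + 2 n (x dy + dz)^2\<close>.  They are the
  more general form of the soliton equation in which the two eigenvalues are independent: the
  relation \<open>n = 2 * m\<close> is an integrability condition, which reflects that a dilation of the
  Heisenberg group scales the centre with twice the weight.
\<close>

lemma frame_system_solution:
  assumes smooth: "smooth_fun a" "smooth_fun b" "smooth_fun h"
    and a_x: "\<And>p. pd 1 a p = m"
    and b_y: "\<And>p. pd 2 b p = m + p$1 * pd 3 b p"
    and h_z: "\<And>p. pd 3 h p = n"
    and b_x: "\<And>p. pd 1 b p = pd 2 a p - p$1 * pd 3 a p"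
    and h_x: "\<And>p. pd 1 h p = pd 3 a p + b p"
    and h_y: "\<And>p. pd 2 h p = p$1 * n - a p - pd 3 b p"
  shows "n = 2 * m"
    and "\<exists>\<kappa>1 \<kappa>2 \<kappa>3 \<kappa>4. \<forall>p. a p = \<kappa>1 * p$2 + m * p$1 + \<kappa>2 \<and> b p = \<kappa>1 * p$1 + m * p$2 + \<kappa>3
      \<and> h p = p$1 * b p - (\<kappa>1 / 2 * (p$1 * p$1 + p$2 * p$2) + \<kappa>2 * p$2 - n * p$3 - \<kappa>4)"
proof -
  define A where "A = pd 3 a"
  define B where "B = pd 3 b"
  have smA: "smooth_fun A" and smB: "smooth_fun B"
    using smooth by (simp_all add: A_def B_def smooth_pd)
  note [simp] = smooth_imp_differentiable[OF smooth(1)] smooth_imp_differentiable[OF smooth(2)]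
    smooth_imp_differentiable[OF smooth(3)] smooth_imp_differentiable[OF smA]
    smooth_imp_differentiable[OF smB] smooth_imp_differentiable[OF smooth_pd[OF smooth(1)]]
    smooth_imp_differentiable[OF smooth_pd[OF smooth(2)]]
  have ax: "pd 1 a = (\<lambda>p. m)" using a_x by blast
  have bx: "pd 1 b = (\<lambda>p. pd 2 a p - p$1 * A p)" using b_x A_def by auto
  have by': "pd 2 b = (\<lambda>p. m + p$1 * B p)" using b_y B_def by auto
  have hx: "pd 1 h = (\<lambda>p. A p + b p)" using h_x A_def by auto
  have hy: "pd 2 h = (\<lambda>p. p$1 * n - a p - B p)" using h_y B_def by auto
  have hz: "pd 3 h = (\<lambda>p. n)" using h_z by blast
  have Ax: "pd 1 A = (\<lambda>p. 0)"
    using smooth_pd_commute[OF smooth(1), of 1 3] by (simp add: A_def ax)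
  have Az: "pd 3 A p = - B p" for p
  proof -
    have "pd 3 (pd 1 h) p = pd 1 (pd 3 h) p"
      using smooth_pd_commute[OF smooth(3)] by metis
    then show ?thesis by (simp add: hx hz B_def[symmetric])
  qed
  have Bx: "pd 1 B p = 0" for p
  proof -
    have "B = (\<lambda>p. - pd 3 A p)" using Az by auto
    then have "pd 1 B p = - pd 1 (pd 3 A) p"
      by (simp add: smooth_imp_differentiable[OF smooth_pd[OF smA]])
    also have "\<dots> = - pd 3 (pd 1 A) p"
      using smooth_pd_commute[OF smA] by metis
    finally show ?thesis by (simp add: Ax)
  qed
  have Bz: "pd 3 B p = - A p" for p
  proof -
    have "pd 3 (pd 2 h) p = pd 2 (pd 3 h) p"
      using smooth_pd_commute[OF smooth(3)] by metis
    then show ?thesis by (simp add: hy hz A_def[symmetric])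
  qed
  \<comment> \<open>\<open>b_z\<close> has zero x-derivative, so differentiating the formula for \<open>b_x\<close> in z must give zero.\<close>
  have Ay: "pd 2 A = (\<lambda>p. - (p$1 * B p))"
  proof
    fix p
    have "pd 3 (pd 1 b) p = pd 1 B p"
      using smooth_pd_commute[OF smooth(2)] unfolding B_def by metis
    moreover have "pd 3 (pd 2 a) p = pd 2 A p"
      using smooth_pd_commute[OF smooth(1)] unfolding A_def by metis
    ultimately show "pd 2 A p = - (p$1 * B p)"
      by (simp add: bx Bx Az)
  qed
  show n: "n = 2 * m"
  proof -
    have "pd 2 (pd 1 h) 0 = pd 1 (pd 2 h) 0"
      using smooth_pd_commute[OF smooth(3)] by metis
    then show ?thesis by (simp add: hx hy Ay by' ax Bx)
  qed
  \<comment> \<open>\<open>A\<close> does not depend on x, so neither does \<open>A_y = - x B\<close>; and \<open>B\<close> itself does not either.\<close>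
  have B0: "B = (\<lambda>p. 0)"
  proof
    fix p
    have "pd 1 (pd 2 A) p = pd 2 (pd 1 A) p"
      using smooth_pd_commute[OF smA] by metis
    then show "B p = 0" by (simp add: Ay Ax Bx)
  qed
  have A0: "A = (\<lambda>p. 0)"
    using Bz by (auto simp: B0)
  have az: "pd 3 a = (\<lambda>p. 0)" and bz: "pd 3 b = (\<lambda>p. 0)"
    using A0 B0 by (simp_all add: A_def B_def)
  have by0: "pd 2 b = (\<lambda>p. m)" using by' by (simp add: B0)
  have bx0: "pd 1 b = pd 2 a" using bx by (simp add: A0)
  have "\<exists>\<kappa>. \<forall>p. pd 2 a p = \<kappa>"
  proof (rule pd_zero_imp_const)
    show "pd 1 (pd 2 a) p = 0" "pd 3 (pd 2 a) p = 0" for p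
      using smooth_pd_commute[OF smooth(1), of 1 2] smooth_pd_commute[OF smooth(1), of 3 2]
      by (simp_all add: ax az)
    show "pd 2 (pd 2 a) p = 0" for p
      using smooth_pd_commute[OF smooth(2), of 2 1] by (simp add: bx0 by0)
  qed simp
  then obtain \<kappa>1 where ay: "pd 2 a = (\<lambda>p. \<kappa>1)" by blast
  have "\<exists>c. \<forall>p. a p - (\<kappa>1 * p$2 + m * p$1) = c"
    by (rule pd_zero_imp_const) (simp_all add: ax ay az)
  then obtain \<kappa>2 where a: "\<And>p. a p = \<kappa>1 * p$2 + m * p$1 + \<kappa>2"
    by (metis diff_eq_eq add.commute)
  have "\<exists>c. \<forall>p. b p - (\<kappa>1 * p$1 + m * p$2) = c"
    by (rule pd_zero_imp_const) (simp_all add: bx0 ay by0 bz)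
  then obtain \<kappa>3 where b: "\<And>p. b p = \<kappa>1 * p$1 + m * p$2 + \<kappa>3"
    by (metis diff_eq_eq add.commute)
  have "\<exists>c. \<forall>p. h p - (p$1 * b p - (\<kappa>1 / 2 * (p$1 * p$1 + p$2 * p$2) + \<kappa>2 * p$2 - n * p$3)) = c"
    by (rule pd_zero_imp_const)
       (simp_all add: hx hy hz bx0 ay by0 bz A0 B0 n a algebra_simps)
  then obtain \<kappa>4 where
    "\<And>p. h p - (p$1 * b p - (\<kappa>1 / 2 * (p$1 * p$1 + p$2 * p$2) + \<kappa>2 * p$2 - n * p$3)) = \<kappa>4"
    by blast
  then have h: "h p = p$1 * b p - (\<kappa>1 / 2 * (p$1 * p$1 + p$2 * p$2) + \<kappa>2 * p$2 - n * p$3 - \<kappa>4)" for p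
    by (simp add: algebra_simps)
  show "\<exists>\<kappa>1 \<kappa>2 \<kappa>3 \<kappa>4. \<forall>p. a p = \<kappa>1 * p$2 + m * p$1 + \<kappa>2 \<and> b p = \<kappa>1 * p$1 + m * p$2 + \<kappa>3
      \<and> h p = p$1 * b p - (\<kappa>1 / 2 * (p$1 * p$1 + p$2 * p$2) + \<kappa>2 * p$2 - n * p$3 - \<kappa>4)"
    using a b h by blast
qed

text \<open>
  The coordinate equations are combined as dictated by the frame: the z-row times x is subtracted
  from the y-row, which amounts to evaluating on \<open>\<partial>_y - x \<partial>_z\<close> instead of \<open>\<partial>_y\<close>.
\<close>

lemma soliton_frame_equations:
  assumes smooth: "smooth_field X"
    and soliton: "lie_derivative X g1 p + cotton g1 p = c *\<^sub>R g1 p"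
  defines "a \<equiv> \<lambda>q. X q $ 1" and "b \<equiv> \<lambda>q. X q $ 2" and "h \<equiv> \<lambda>q. q$1 * X q $ 2 + X q $ 3"
  shows "pd 1 a p = (c - 1/2) / 2"
    and "pd 2 b p = (c - 1/2) / 2 + p$1 * pd 3 b p"
    and "pd 3 h p = (c + 1) / 2"
    and "pd 1 b p = pd 2 a p - p$1 * pd 3 a p"
    and "pd 1 h p = pd 3 a p + b p"
    and "pd 2 h p = p$1 * ((c + 1) / 2) - a p - pd 3 b p"
proof -
  define w where "w = (\<lambda>q. X q $ 3)"
  have diff: "(\<lambda>q. X q $ i) differentiable (at p)" for i
    using smooth smooth_imp_differentiable by (auto simp: smooth_field_def)
  have h: "pd 1 h p = b p + p$1 * pd 1 b p + pd 1 w p"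
    "pd 2 h p = p$1 * pd 2 b p + pd 2 w p"
    "pd 3 h p = p$1 * pd 3 b p + pd 3 w p"
    by (simp_all add: h_def b_def w_def diff)
  have "(lie_derivative X g1 p + cotton g1 p) $ i $ j = (c *\<^sub>R g1 p) $ i $ j" for i j
    by (simp add: soliton)
  note E = this[unfolded lie_derivative_def sum_3 cotton_g1]
  have E11: "2 * pd 1 a p = c - 1/2"
    using E[of 1 1] by (simp add: g1_nth a_def)
  have E12: "(1 + p$1 * p$1) * pd 1 b p + p$1 * pd 1 w p = pd 2 a p"
    using E[of 1 2] by (simp add: g1_nth a_def b_def w_def)
  have E13: "p$1 * pd 1 b p + pd 1 w p = pd 3 a p"
    using E[of 1 3] by (simp add: g1_nth a_def b_def w_def)
  have E22: "2 * p$1 * a p + 2 * (1 + p$1 * p$1) * pd 2 b p + 2 * p$1 * pd 2 w p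
      + 1/2 - p$1 * p$1 = c * (1 + p$1 * p$1)"
    using E[of 2 2] by (simp add: g1_nth a_def b_def w_def algebra_simps)
  have E23: "a p + (1 + p$1 * p$1) * pd 3 b p + p$1 * pd 3 w p + p$1 * pd 2 b p + pd 2 w p - p$1
      = c * p$1"
    using E[of 2 3] by (simp add: g1_nth a_def b_def w_def algebra_simps)
  have E33: "2 * (p$1 * pd 3 b p + pd 3 w p) - 1 = c"
    using E[of 3 3] by (simp add: g1_nth a_def b_def w_def algebra_simps)
  show "pd 1 a p = (c - 1/2) / 2"
    using E11 by simp
  show "pd 3 h p = (c + 1) / 2"
    using E33 h by simp
  show "pd 1 h p = pd 3 a p + b p"
    using E13 h by simp
  show "pd 1 b p = pd 2 a p - p$1 * pd 3 a p"
    using E12 unfolding E13[symmetric] by (simp add: algebra_simps)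
  have e23: "a p + pd 3 b p + pd 2 h p = p$1 * ((c + 1) / 2)"
    using E23 E33 h(2) by algebra
  then show "pd 2 h p = p$1 * ((c + 1) / 2) - a p - pd 3 b p"
    by simp
  have "2 * pd 2 b p = c - 1/2 + 2 * (p$1 * pd 3 b p)"
    using E22 e23 h(2) by algebra
  then show "pd 2 b p = (c - 1/2) / 2 + p$1 * pd 3 b p"
    by (simp add: field_simps)
qed

definition soliton_field :: "real \<Rightarrow> real \<Rightarrow> real \<Rightarrow> real \<Rightarrow> vector_field" where
  "soliton_field \<kappa>1 \<kappa>2 \<kappa>3 \<kappa>4 p = vector
     [\<kappa>1 * p$2 + 3/4 * p$1 + \<kappa>2,
      \<kappa>1 * p$1 + 3/4 * p$2 + \<kappa>3,
      - (\<kappa>1 / 2 * (p$1 * p$1 + p$2 * p$2) + \<kappa>2 * p$2 - 3/2 * p$3 - \<kappa>4)]"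

lemma eq_soliton_field_iff:
  "X = soliton_field \<kappa>1 \<kappa>2 \<kappa>3 \<kappa>4 \<longleftrightarrow> (\<forall>x y z. X (vector [x, y, z]) = vector
     [\<kappa>1 * y + 3/4 * x + \<kappa>2, \<kappa>1 * x + 3/4 * y + \<kappa>3,
      - (\<kappa>1 / 2 * (x^2 + y^2) + \<kappa>2 * y - 3/2 * z - \<kappa>4)])"
  unfolding fun_eq_iff forall_vector_3 by (simp add: soliton_field_def power2_eq_square)

lemma cotton_soliton_imp_soliton_field:
  assumes "cotton_soliton g1 X c"
  shows "c = 2 \<and> (\<exists>\<kappa>1 \<kappa>2 \<kappa>3 \<kappa>4. X = soliton_field \<kappa>1 \<kappa>2 \<kappa>3 \<kappa>4)"
proof -
  have sm: "smooth_field X" and sol: "\<And>p. lie_derivative X g1 p + cotton g1 p = c *\<^sub>R g1 p"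
    using assms by (auto simp: cotton_soliton_def)
  have smX: "smooth_fun (\<lambda>q. X q $ i)" for i
    using sm by (simp add: smooth_field_def)
  then have smh: "smooth_fun (\<lambda>q. q$1 * X q $ 2 + X q $ 3)"
    by (intro smooth_add smooth_mult smooth_coord)
  note solution = frame_system_solution[OF smX smX smh soliton_frame_equations[OF sm sol]]
  from solution(1) have c: "c = 2" by simp
  with solution(2) obtain \<kappa>1 \<kappa>2 \<kappa>3 \<kappa>4 where *:
    "\<And>p. X p $ 1 = \<kappa>1 * p$2 + 3/4 * p$1 + \<kappa>2 \<and> X p $ 2 = \<kappa>1 * p$1 + 3/4 * p$2 + \<kappa>3
      \<and> p$1 * X p $ 2 + X p $ 3 = p$1 * X p $ 2
        - (\<kappa>1 / 2 * (p$1 * p$1 + p$2 * p$2) + \<kappa>2 * p$2 - 3/2 * p$3 - \<kappa>4)"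
    by auto
  have "X = soliton_field \<kappa>1 \<kappa>2 \<kappa>3 \<kappa>4"
    by (rule ext) (use * in \<open>simp add: vec_eq_iff forall_3 soliton_field_def\<close>)
  with c show ?thesis by blast
qed

text \<open>Sums and products only, so that the closure properties of smooth functions apply.\<close>

lemma soliton_field_nth:
  "(\<lambda>p. soliton_field \<kappa>1 \<kappa>2 \<kappa>3 \<kappa>4 p $ 1) = (\<lambda>p. \<kappa>1 * p$2 + 3/4 * p$1 + \<kappa>2)"
  "(\<lambda>p. soliton_field \<kappa>1 \<kappa>2 \<kappa>3 \<kappa>4 p $ 2) = (\<lambda>p. \<kappa>1 * p$1 + 3/4 * p$2 + \<kappa>3)"
  "(\<lambda>p. soliton_field \<kappa>1 \<kappa>2 \<kappa>3 \<kappa>4 p $ 3)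
    = (\<lambda>p. (- \<kappa>1 / 2) * (p$1 * p$1 + p$2 * p$2) + (- \<kappa>2) * p$2 + 3/2 * p$3 + \<kappa>4)"
  by (simp_all add: soliton_field_def fun_eq_iff algebra_simps)

lemma cotton_soliton_soliton_field: "cotton_soliton g1 (soliton_field \<kappa>1 \<kappa>2 \<kappa>3 \<kappa>4) 2"
  unfolding cotton_soliton_def
proof (intro conjI allI)
  show "smooth_field (soliton_field \<kappa>1 \<kappa>2 \<kappa>3 \<kappa>4)"
    unfolding smooth_field_def forall_3 soliton_field_nth
    by (intro conjI smooth_add smooth_mult smooth_const smooth_coord)
  show "lie_derivative (soliton_field \<kappa>1 \<kappa>2 \<kappa>3 \<kappa>4) g1 p + cotton g1 p = 2 *\<^sub>R g1 p" for p
    by (simp add: vec_eq_iff forall_3 lie_derivative_def sum_3 g1_nth cotton_g1 soliton_field_nth)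
       (simp add: soliton_field_def field_simps)
qed

section \<open>No soliton is left-invariant or gradient\<close>

lemma soliton_field_not_left_invariant: "\<not> left_invariant (soliton_field \<kappa>1 \<kappa>2 \<kappa>3 \<kappa>4)"
proof
  assume "left_invariant (soliton_field \<kappa>1 \<kappa>2 \<kappa>3 \<kappa>4)"
  then obtain \<alpha> where \<alpha>: "\<And>p. soliton_field \<kappa>1 \<kappa>2 \<kappa>3 \<kappa>4 p $ 1 = \<alpha>"
    by (auto simp: left_invariant_def)
  from \<alpha>[of 0] \<alpha>[of "axis 1 1"] show False
    by (simp add: soliton_field_def axis_def)
qed

text \<open>
  Lowering the index of a gradient field gives an exact 1-form, hence a closed one; here the
  (x,z)-component of its exterior derivative is, up to sign, the component \<open>b\<close> of the field.
\<close>

lemma soliton_field_not_gradient: "\<not> is_gradient_field g1 (soliton_field \<kappa>1 \<kappa>2 \<kappa>3 \<kappa>4)"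
proof
  assume "is_gradient_field g1 (soliton_field \<kappa>1 \<kappa>2 \<kappa>3 \<kappa>4)"
  then obtain f where f: "smooth_fun f" and X: "soliton_field \<kappa>1 \<kappa>2 \<kappa>3 \<kappa>4 = gradient g1 f"
    by (auto simp: is_gradient_field_def)
  note comp = soliton_field_nth[of \<kappa>1 \<kappa>2 \<kappa>3 \<kappa>4, unfolded X]
  have grad: "gradient g1 f p = vector [- pd 1 f p, pd 2 f p - p$1 * pd 3 f p,
      - p$1 * pd 2 f p + (1 + p$1 * p$1) * pd 3 f p]" for p
    by (simp add: vec_eq_iff forall_3 gradient_def matrix_vector_mult_def sum_3 matrix_inv_g1)
  have f_x: "pd 1 f = (\<lambda>p. - (\<kappa>1 * p$2 + 3/4 * p$1 + \<kappa>2))"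
  proof
    fix p
    have "- pd 1 f p = \<kappa>1 * p$2 + 3/4 * p$1 + \<kappa>2"
      using fun_cong[OF comp(1), of p] by (simp add: grad)
    then show "pd 1 f p = - (\<kappa>1 * p$2 + 3/4 * p$1 + \<kappa>2)"
      by linarith
  qed
  have f_z: "pd 3 f = (\<lambda>p. p$1 * (\<kappa>1 * p$1 + 3/4 * p$2 + \<kappa>3)
      + ((- \<kappa>1 / 2) * (p$1 * p$1 + p$2 * p$2) + (- \<kappa>2) * p$2 + 3/2 * p$3 + \<kappa>4))"
  proof
    fix p
    have "pd 3 f p = p$1 * gradient g1 f p $ 2 + gradient g1 f p $ 3"
      by (simp add: grad algebra_simps)
    then show "pd 3 f p = p$1 * (\<kappa>1 * p$1 + 3/4 * p$2 + \<kappa>3)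
      + ((- \<kappa>1 / 2) * (p$1 * p$1 + p$2 * p$2) + (- \<kappa>2) * p$2 + 3/2 * p$3 + \<kappa>4)"
      using fun_cong[OF comp(2), of p] fun_cong[OF comp(3), of p] by simp
  qed
  have "\<kappa>1 * p$1 + 3/4 * p$2 + \<kappa>3 = 0" for p :: "real^3"
  proof -
    have "pd 1 (pd 3 f) p = pd 3 (pd 1 f) p"
      using smooth_pd_commute[OF f] by metis
    then show ?thesis by (simp add: f_x f_z algebra_simps)
  qed
  from this[of 0] this[of "axis 2 1"] show False
    by (simp add: axis_def)
qed

theorem mainTheorem11:
  shows "(\<forall>(X :: real^3 \<Rightarrow> real^3) (c :: real).
            cotton_soliton g1 X c \<longleftrightarrow>
              c = 2 \<and>
              (\<exists>\<kappa>1 \<kappa>2 \<kappa>3 \<kappa>4 :: real. \<forall>x y z :: real.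
                 X (vector [x, y, z]) =
                   vector [\<kappa>1 * y + 3/4 * x + \<kappa>2,
                           \<kappa>1 * x + 3/4 * y + \<kappa>3,
                           - (\<kappa>1 / 2 * (x^2 + y^2) + \<kappa>2 * y - 3/2 * z - \<kappa>4)]))
       \<and> (\<exists>p. cotton g1 p \<noteq> 0)
       \<and> (\<forall>(X :: real^3 \<Rightarrow> real^3) (c :: real).
            cotton_soliton g1 X c \<longrightarrow> \<not> left_invariant X \<and> \<not> is_gradient_field g1 X)"
proof -
  have classification: "cotton_soliton g1 X c \<longleftrightarrow>
      c = 2 \<and> (\<exists>\<kappa>1 \<kappa>2 \<kappa>3 \<kappa>4. X = soliton_field \<kappa>1 \<kappa>2 \<kappa>3 \<kappa>4)" for X c
    using cotton_soliton_imp_soliton_field cotton_soliton_soliton_field by blast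
  have "cotton g1 0 $ 3 $ 3 \<noteq> 0"
    by (simp add: cotton_g1)
  then have "\<exists>p. cotton g1 p \<noteq> 0"
    by (metis zero_index)
  with classification soliton_field_not_left_invariant soliton_field_not_gradient show ?thesis
    unfolding eq_soliton_field_iff[symmetric] by (auto simp: classification)
qed

end
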